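(* Let $p = \frac{\log n + \omega(1)}{n}$ (that is, $p=\frac{\log n + w(n)}{n}$ for some function $w(n)\to\infty$). There exist constants $\varepsilon>0$ and $c>0$ such that with high probability the random graph $G\sim G(n,p)$ has the following property: for every 2-edge-coloring of $G$ there exists a spanning tree $T$ of $G$ with at least $cn$ leaves in which more than $\frac{1+\varepsilon}{2}n$ of the edges of $T$ receive the same color.
   Context: $G(n,p)$ denotes the binomial random graph on $n$ vertices where each pair of distinct vertices is joined independently with probability $p$. "With high probability" means with probability tending to $1$ as $n\to\infty$. A leaf of a tree is a vertex of degree $1$. The paper phrases the leaf condition as "a linear number of leaves" and states that $\varepsilon$ is an absolute constant independent of $p$. *)

theory Defs
  imports "HOL-Probability.Probability"
begin

text \<open>
  A simple graph is given by a vertex set \<open>V\<close> and a set \<open>E\<close> of two-element subsets of \<open>V\<close>.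
\<close>

definition all_edges :: "'a set \<Rightarrow> 'a set set" where
  "all_edges V = {e. e \<subseteq> V \<and> card e = 2}"

definition connected_graph :: "'a set \<Rightarrow> 'a set set \<Rightarrow> bool" where
  "connected_graph V E \<longleftrightarrow>
     V \<noteq> {} \<and> (\<forall>u\<in>V. \<forall>v\<in>V. (u, v) \<in> {(x, y). {x, y} \<in> E}\<^sup>*)"

text \<open>
  A cycle is listed by its vertices in cyclic order, without repeating the first one at the end.
\<close>

definition graph_cycle :: "'a set set \<Rightarrow> 'a list \<Rightarrow> bool" where
  "graph_cycle E xs \<longleftrightarrow>
     3 \<le> length xs \<and> distinct xs \<and>
     (\<forall>i<length xs. {xs ! i, xs ! (Suc i mod length xs)} \<in> E)"

definition tree :: "'a set \<Rightarrow> 'a set set \<Rightarrow> bool" where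
  "tree V T \<longleftrightarrow>
     T \<subseteq> all_edges V \<and> connected_graph V T \<and> (\<nexists>xs. graph_cycle T xs)"

definition spanning_tree :: "'a set \<Rightarrow> 'a set set \<Rightarrow> 'a set set \<Rightarrow> bool" where
  "spanning_tree V E T \<longleftrightarrow> T \<subseteq> E \<and> tree V T"

definition degree :: "'a set set \<Rightarrow> 'a \<Rightarrow> nat" where
  "degree E v = card {e \<in> E. v \<in> e}"

definition leaves :: "'a set \<Rightarrow> 'a set set \<Rightarrow> 'a set" where
  "leaves V T = {v \<in> V. degree T v = 1}"

text \<open>
  The distribution of the edge set of \<open>G(n,p)\<close> on the vertex set \<open>{..<n}\<close>. It is meant for
  \<open>0 \<le> p \<le> 1\<close>; outside this range \<open>bernoulli_pmf\<close> truncates \<open>p\<close> to the unit interval.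
\<close>

definition gnp :: "nat \<Rightarrow> real \<Rightarrow> nat set set pmf" where
  "gnp n p =
     map_pmf (\<lambda>f. {e \<in> all_edges {..<n}. f e})
       (Pi_pmf (all_edges {..<n}) False (\<lambda>_. bernoulli_pmf p))"

end

theory Submission
  imports Defs "HOL-Real_Asymp.Real_Asymp"
begin

text \<open>
  With high probability \<open>G\<close> is connected, and any two disjoint sets of \<open>k = n div 20\<close> vertices are
  joined by an edge. These two properties suffice. Joinedness gives a star forest \<open>S\<close> with \<open>k\<close> centres
  and between \<open>3k\<close> and \<open>4k\<close> leaves; since the degrees of a tree sum to \<open>2n - 2\<close>, every spanning tree
  containing \<open>S\<close> has at least \<open>k\<close> leaves. Extend \<open>S\<close> greedily by red edges to a forest \<open>F1\<close>, and
  likewise by blue edges to \<open>F2\<close>. Every edge of \<open>G\<close> lies inside a component of \<open>F1\<close> or of \<open>F2\<close>. If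
  both forests had \<open>3k\<close> components, there would be two \<open>k\<close>-sets that share no component of either
  forest, hence without an edge between them. So one of the forests has fewer than \<open>3k\<close> components, and
  it extends to a spanning tree with at least \<open>n - 7k\<close> edges of one colour.
\<close>

section \<open>Forests with component labels\<close>

text \<open>
  As in a union-find structure, \<open>f\<close> maps each vertex to a representative of its component in the
  forest \<open>T\<close>.
\<close>

inductive labelled_forest :: "'a set set \<Rightarrow> ('a \<Rightarrow> 'a) \<Rightarrow> bool" where
  empty: "labelled_forest {} id"
| insert: "labelled_forest T f \<Longrightarrow> f x \<noteq> f y \<Longrightarrow>
    labelled_forest (insert {x, y} T) (\<lambda>z. if f z = f y then f x else f z)"

lemma labelled_forest_edge:
  assumes "labelled_forest T f" "{u, v} \<in> T"
  shows "f u = f v"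
  using assms by (induction arbitrary: u v) (auto simp: doubleton_eq_iff)

lemma labelled_forest_connected:
  assumes "labelled_forest T f" "f u = f v"
  shows "(u, v) \<in> {(x, y). {x, y} \<in> T}\<^sup>*"
  using assms
proof (induction arbitrary: u v)
  case empty
  then show ?case by simp
next
  case (insert T f x y)
  let ?R = "{(x, y). {x, y} \<in> T}" and ?R' = "{(a, b). {a, b} \<in> Set.insert {x, y} T}"
  have mono: "?R\<^sup>* \<subseteq> ?R'\<^sup>*" by (rule rtrancl_mono) auto
  have IH: "(a, b) \<in> ?R'\<^sup>*" if "f a = f b" for a b
    using insert.IH[OF that] mono by blast
  have xy: "(x, y) \<in> ?R'\<^sup>*" "(y, x) \<in> ?R'\<^sup>*"
    by (auto intro!: r_into_rtrancl simp: insert_commute)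
  \<comment> \<open>Equal labels after the merge mean equal labels before it, or one vertex in each
    of the two merged classes; in that case the path crosses the new edge.\<close>
  consider "f u = f v" | "f u = f x" "f y = f v" | "f u = f y" "f x = f v"
    using insert.prems by (simp split: if_splits)
  then show ?case
  proof cases
    case 1
    then show ?thesis by (rule IH)
  next
    case 2
    show ?thesis
      by (rule rtrancl_trans[OF IH[OF 2(1)] rtrancl_trans[OF xy(1) IH[OF 2(2)]]])
  next
    case 3
    show ?thesis
      by (rule rtrancl_trans[OF IH[OF 3(1)] rtrancl_trans[OF xy(2) IH[OF 3(2)]]])
  qed
qed

section \<open>Acyclicity of labelled forests\<close>

lemma cycle_edges_distinct:
  assumes "distinct xs" "3 \<le> length xs" "i < length xs" "j < length xs" "i \<noteq> j"
  shows "{xs ! i, xs ! (Suc i mod length xs)} \<noteq> {xs ! j, xs ! (Suc j mod length xs)}"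
proof
  assume eq: "{xs ! i, xs ! (Suc i mod length xs)} = {xs ! j, xs ! (Suc j mod length xs)}"
  have suc: "Suc l mod length xs = (if Suc l = length xs then 0 else Suc l)" if "l < length xs" for l
    using that by (simp add: mod_Suc)
  have lt: "Suc i mod length xs < length xs" "Suc j mod length xs < length xs"
    using assms(2) by (intro mod_less_divisor; linarith)+
  have "xs ! i \<noteq> xs ! j"
    using assms by (simp add: nth_eq_iff_index_eq)
  with eq have "xs ! i = xs ! (Suc j mod length xs)" "xs ! (Suc i mod length xs) = xs ! j"
    by (simp_all only: doubleton_eq_iff) blast+
  then have "i = Suc j mod length xs" "Suc i mod length xs = j"
    using nth_eq_iff_index_eq[OF assms(1,3) lt(2)] nth_eq_iff_index_eq[OF assms(1) lt(1) assms(4)]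
    by blast+
  \<comment> \<open>Each of \<open>i\<close> and \<open>j\<close> would be the cyclic successor of
    the other, which is possible only in a cycle of length at most 2.\<close>
  then show False
    using suc[OF assms(3)] suc[OF assms(4)] assms(2) by (simp only: split: if_splits)
qed

text \<open>The edges of a cycle are pairwise distinct, so the new edge occurs at a single position.
  The rest of the cycle is a walk in \<open>T\<close> between its ends, and \<open>f\<close> is
  constant along that walk.\<close>

lemma cycle_closing_edge:
  assumes cyc: "graph_cycle (insert {x, y} T) xs" and ncyc: "\<not> graph_cycle T xs"
    and lab: "\<And>u v. {u, v} \<in> T \<Longrightarrow> f u = f v"
  shows "f x = f y"
proof -
  let ?m = "length xs"
  have m: "3 \<le> ?m" and d: "distinct xs"
    and e: "\<And>i. i < ?m \<Longrightarrow> {xs ! i, xs ! (Suc i mod ?m)} \<in> insert {x, y} T"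
    using cyc unfolding graph_cycle_def by blast+
  obtain i where i: "i < ?m" "{xs ! i, xs ! (Suc i mod ?m)} \<notin> T"
    using ncyc m d unfolding graph_cycle_def by blast
  have ixy: "{xs ! i, xs ! (Suc i mod ?m)} = {x, y}"
    using e[OF i(1)] i(2) by blast
  have step: "f (xs ! j) = f (xs ! (Suc j mod ?m))" if "j < ?m" "j \<noteq> i" for j
  proof (rule lab)
    have "{xs ! j, xs ! (Suc j mod ?m)} \<noteq> {x, y}"
      using cycle_edges_distinct[OF d m that(1) i(1) that(2)] unfolding ixy .
    then show "{xs ! j, xs ! (Suc j mod ?m)} \<in> T"
      using e[OF that(1)] by blast
  qed
  have walk: "f (xs ! ((Suc i + t) mod ?m)) = f (xs ! (Suc i mod ?m))" if "t < ?m" for t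
    using that
  proof (induction t)
    case 0
    show ?case by simp
  next
    case (Suc t)
    \<comment> \<open>Starting just after position \<open>i\<close>, the walk returns to
      \<open>i\<close> only after \<open>?m - 1\<close> steps, and here \<open>t\<close> is still
      smaller.\<close>
    have "(Suc i + t) mod ?m \<noteq> i"
    proof (cases "Suc i + t < ?m")
      case False
      then have "(Suc i + t) mod ?m = Suc i + t - ?m"
        using Suc.prems i(1) by (simp add: le_mod_geq)
      then show ?thesis using Suc.prems False by linarith
    qed simp
    moreover have "(Suc i + t) mod ?m < ?m"
      using m by (intro mod_less_divisor) linarith
    ultimately have "f (xs ! ((Suc i + t) mod ?m)) = f (xs ! (Suc (Suc i + t) mod ?m))"
      using step[of "(Suc i + t) mod ?m"] by (simp add: mod_Suc_eq)
    then show ?case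
      using Suc.IH Suc.prems by simp
  qed
  have "Suc i + (?m - 1) = i + ?m"
    using m by linarith
  then have "(Suc i + (?m - 1)) mod ?m = i"
    using i(1) by simp
  then have "f (xs ! i) = f (xs ! (Suc i mod ?m))"
    using walk[of "?m - 1"] m by (metis One_nat_def diff_less length_greater_0_conv list.size(3)
        not_numeral_le_zero zero_less_one)
  then show ?thesis
    using ixy unfolding doubleton_eq_iff by (elim disjE conjE) simp_all
qed

lemma labelled_forest_acyclic:
  assumes "labelled_forest T f"
  shows "\<nexists>xs. graph_cycle T xs"
  using assms
proof induction
  case empty
  have "\<not> graph_cycle {} xs" for xs :: "'a list"
    by (cases xs) (auto simp: graph_cycle_def)
  then show ?case by blast
next
  case (insert T f x y)
  then show ?case
    using cycle_closing_edge[of x y T _ f] labelled_forest_edge[of T f] by blast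
qed

section \<open>Counting components, extending forests, and star forests\<close>

lemma finite_all_edges: "finite V \<Longrightarrow> finite (all_edges V)"
  by (rule finite_subset[of _ "Pow V"]) (auto simp: all_edges_def)

text \<open>Each insertion adds one new edge and removes exactly one label from the image of
  \<open>V\<close>, namely \<open>f y\<close>.\<close>

lemma labelled_forest_card:
  assumes "labelled_forest T f" "T \<subseteq> all_edges V" "finite V"
  shows "card (f ` V) + card T = card V"
  using assms
proof induction
  case empty
  then show ?case by simp
next
  case (insert T f x y)
  have V: "x \<in> V" "y \<in> V"
    using insert.prems(1) by (auto simp: all_edges_def)
  have "{x, y} \<notin> T"
    using labelled_forest_edge insert.hyps by metis
  moreover have "finite T"
    using insert.prems finite_all_edges finite_subset by (metis insert_subset)
  moreover have "(\<lambda>z. if f z = f y then f x else f z) ` V = f ` V - {f y}"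
    using V insert.hyps by (auto simp: image_iff)
  moreover have "Suc (card (f ` V - {f y})) = card (f ` V)"
    using V insert.prems by (intro card_Suc_Diff1) auto
  ultimately show ?case
    using insert by simp
qed

text \<open>Kruskal's greedy procedure: an edge is added exactly when its ends still have different
  labels. It serves both for the one-coloured extensions and for completing a forest to a spanning
  tree.\<close>

lemma labelled_forest_extend:
  assumes "finite E" "labelled_forest T f"
  shows "\<exists>T' f'. labelled_forest T' f' \<and> T \<subseteq> T' \<and> T' \<subseteq> T \<union> E \<and>
    (\<forall>u v. {u, v} \<in> E \<longrightarrow> f' u = f' v)"
  using assms(1)
proof induction
  case empty
  then show ?case using assms(2) by auto
next
  case (insert e E)
  then obtain T' f' where IH: "labelled_forest T' f'" "T \<subseteq> T'" "T' \<subseteq> T \<union> E"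
    "\<And>u v. {u, v} \<in> E \<Longrightarrow> f' u = f' v"
    by blast
  show ?case
  \<comment> \<open>The set \<open>e\<close> is not assumed to have two elements; if it is not of
    the form \<open>{x, y}\<close>, the condition on labels is vacuous for it.\<close>
  proof (cases "\<exists>x y. e = {x, y} \<and> f' x \<noteq> f' y")
    case True
    then obtain x y where xy: "e = {x, y}" "f' x \<noteq> f' y" by blast
    let ?f = "\<lambda>z. if f' z = f' y then f' x else f' z"
    have "\<forall>u v. {u, v} \<in> Set.insert e E \<longrightarrow> ?f u = ?f v"
      using IH(4) xy by (auto simp: doubleton_eq_iff)
    then show ?thesis
      using labelled_forest.insert[OF IH(1) xy(2)] IH(2,3) xy(1)
      by (intro exI[of _ "Set.insert e T'"] exI[of _ ?f]) auto
  next
    case False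
    then show ?thesis
      using IH by (intro exI[of _ T'] exI[of _ f']) auto
  qed
qed

lemma labelled_forest_stars:
  assumes "finite A" "h ` A \<inter> A = {}"
  shows "labelled_forest ((\<lambda>a. {h a, a}) ` A) (\<lambda>z. if z \<in> A then h z else z)"
  using assms
proof induction
  case empty
  then show ?case using labelled_forest.empty by (simp add: id_def)
next
  case (insert a A)
  let ?f = "\<lambda>z. if z \<in> A then h z else z"
  have f: "labelled_forest ((\<lambda>a. {h a, a}) ` A) ?f"
    using insert by auto
  have ne: "?f (h a) \<noteq> ?f a"
    using insert by auto
  \<comment> \<open>Before its insertion \<open>a\<close> is alone in its class, so merging that
    class into the one of \<open>h a\<close> relabels only \<open>a\<close>.\<close>
  have "(\<lambda>z. if ?f z = ?f a then ?f (h a) else ?f z) = (\<lambda>z. if z \<in> Set.insert a A then h z else z)"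
    using insert by (auto simp: fun_eq_iff)
  then show ?case
    using labelled_forest.insert[OF f ne] by simp
qed

text \<open>
  View each \<open>v\<close> as an edge between the class \<open>f v\<close> and the class \<open>g v\<close> of a bipartite graph. A matching
  with \<open>2k\<close> edges can be cut in half. If there is none, a maximal matching yields a vertex cover with
  few classes on either side, and the edges that leave it on the left and on the right are disjoint.
\<close>

lemma two_labellings_split:
  fixes f g :: "'a \<Rightarrow> 'b"
  assumes fin: "finite V" and f: "3 * k \<le> card (f ` V)" and g: "3 * k \<le> card (g ` V)"
  shows "\<exists>A B. A \<subseteq> V \<and> B \<subseteq> V \<and> k \<le> card A \<and> k \<le> card B \<and>
    f ` A \<inter> f ` B = {} \<and> g ` A \<inter> g ` B = {}"
proof -
  let ?P = "\<lambda>M. M \<subseteq> V \<and> inj_on f M \<and> inj_on g M"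
  have "\<exists>M. ?P M \<and> (\<forall>N. ?P N \<longrightarrow> card N \<le> card M)"
    by (rule ex_has_greatest_nat[of _ "{}" _ "Suc (card V)"])
      (use fin in \<open>auto simp: less_Suc_eq_le card_mono\<close>)
  then obtain M where M: "?P M" and max: "\<And>N. ?P N \<Longrightarrow> card N \<le> card M" by blast
  have finM: "finite M" using M fin finite_subset by blast
  have cov: "f v \<in> f ` M \<or> g v \<in> g ` M" if "v \<in> V" for v
  proof (rule ccontr)
    assume c: "\<not> ?thesis"
    then have "?P (insert v M)" "v \<notin> M" using M that by auto
    with max[of "insert v M"] finM show False by simp
  qed
  show ?thesis
  proof (cases "2 * k \<le> card M")
    case True
    then obtain A where A: "A \<subseteq> M" "card A = k"
      by (metis le_add2 mult_2 le_trans obtain_subset_with_card_n)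
    have "card (M - A) = card M - k"
      using A finM by (simp add: card_Diff_subset finite_subset)
    moreover have "f ` A \<inter> f ` (M - A) = {}" "g ` A \<inter> g ` (M - A) = {}"
      using M A by (auto dest: inj_onD)
    ultimately show ?thesis
      using A M True by (intro exI[of _ A] exI[of _ "M - A"]) auto
  next
    case False
    let ?A = "{v \<in> V. f v \<notin> f ` M}" and ?B = "{v \<in> V. g v \<notin> g ` M}"
    \<comment> \<open>The matching meets fewer than \<open>2 * k\<close> of the at least
      \<open>3 * k\<close> classes, and each class that it misses contains a vertex.\<close>
    have *: "k \<le> card {v \<in> V. h v \<notin> h ` M}" if "3 * k \<le> card (h ` V)" for h :: "'a \<Rightarrow> 'b"
    proof -
      have "h ` V \<subseteq> h ` {v \<in> V. h v \<notin> h ` M} \<union> h ` M" by auto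
      then have "card (h ` V) \<le> card (h ` {v \<in> V. h v \<notin> h ` M} \<union> h ` M)"
        using fin finM by (intro card_mono) auto
      also have "\<dots> \<le> card (h ` {v \<in> V. h v \<notin> h ` M}) + card (h ` M)"
        by (rule card_Un_le)
      also have "\<dots> \<le> card {v \<in> V. h v \<notin> h ` M} + card M"
        using fin finM by (intro add_mono card_image_le) auto
      finally show ?thesis using that False by linarith
    qed
    \<comment> \<open>By \<open>cov\<close>, \<open>a\<close> has an unmatched
      \<open>f\<close>-class and a matched \<open>g\<close>-class, while for \<open>b\<close> it is
      the other way round.\<close>
    have "f a \<noteq> f b \<and> g a \<noteq> g b" if "a \<in> ?A" "b \<in> ?B" for a b
      using cov[of a] cov[of b] that by auto
    then have "f ` ?A \<inter> f ` ?B = {}" "g ` ?A \<inter> g ` ?B = {}"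
      by (blast, blast)
    then show ?thesis
      using *[OF f] *[OF g] by (intro exI[of _ ?A] exI[of _ ?B]) auto
  qed
qed

section \<open>Leaves\<close>

lemma handshake:
  assumes "finite V" "T \<subseteq> all_edges V"
  shows "(\<Sum>v\<in>V. degree T v) = 2 * card T"
proof -
  have fT: "finite T" using assms finite_all_edges finite_subset by blast
  have "(\<Sum>v\<in>V. degree T v) = (\<Sum>v\<in>V. \<Sum>e\<in>T. if v \<in> e then 1 else 0)"
    using fT by (simp add: degree_def sum.If_cases Int_def)
  also have "\<dots> = (\<Sum>e\<in>T. \<Sum>v\<in>V. if v \<in> e then 1 else 0)"
    by (rule sum.swap)
  also have "\<dots> = (\<Sum>e\<in>T. 2)"
  proof (rule sum.cong[OF refl])
    fix e assume "e \<in> T"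
    then have "V \<inter> e = e" "card e = 2" using assms(2) by (auto simp: all_edges_def)
    then show "(\<Sum>v\<in>V. if v \<in> e then 1 else 0) = (2::nat)"
      using assms(1) by (simp add: sum.If_cases)
  qed
  finally show ?thesis by simp
qed

lemma connected_degree_pos:
  assumes "finite T" "connected_graph V T" "v \<in> V" "2 \<le> card V"
  shows "1 \<le> degree T v"
proof -
  obtain u where u: "u \<in> V" "u \<noteq> v"
    using assms(3,4) by (metis card_le_Suc0_iff_eq card.infinite not_less_eq_eq
        numeral_2_eq_2 zero_le)
  then have "(v, u) \<in> {(x, y). {x, y} \<in> T}\<^sup>*"
    using assms by (auto simp: connected_graph_def)
  then obtain z where "{v, z} \<in> T"
    using u(2) by (metis (mono_tags, lifting) converse_rtranclE mem_Collect_eq case_prodD)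
  then have "{e \<in> T. v \<in> e} \<noteq> {}" by auto
  then show ?thesis
    using assms(1) by (simp add: degree_def Suc_le_eq card_gt_0_iff)
qed

text \<open>The degrees sum to at most \<open>2 * card V - 2\<close>, so the average degree is below
  2. Any excess over 2 per vertex inside \<open>B\<close> must be offset by vertices of degree below
  2, and in a connected graph those are leaves.\<close>

lemma leaves_ge_of_degree_sum:
  assumes fin: "finite V" and T: "T \<subseteq> all_edges V" and con: "connected_graph V T"
    and cT: "card T < card V" and V2: "2 \<le> card V" and B: "B \<subseteq> V"
  shows "(\<Sum>v\<in>B. degree T v) \<le> card (leaves V T) + 2 * card B"
proof -
  have fT: "finite T" using fin T finite_all_edges finite_subset by blast
  have fB: "finite B" using fin B finite_subset by blast
  have fL: "finite (leaves V T)" using fin by (simp add: leaves_def)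
  have ge: "2 \<le> degree T v + (if v \<in> leaves V T then 1 else 0)" if "v \<in> V" for v
    using connected_degree_pos[OF fT con that V2] that by (auto simp: leaves_def)
  have "(\<Sum>v\<in>V - B. 2) \<le> (\<Sum>v\<in>V - B. degree T v + (if v \<in> leaves V T then 1 else 0))"
    by (rule sum_mono, rule ge) blast
  also have "\<dots> = (\<Sum>v\<in>V - B. degree T v) + card ((V - B) \<inter> leaves V T)"
    using fin by (simp add: sum.distrib sum.If_cases)
  also have "card ((V - B) \<inter> leaves V T) \<le> card (leaves V T)"
    by (rule card_mono[OF fL]) blast
  finally have "2 * card (V - B) \<le> (\<Sum>v\<in>V - B. degree T v) + card (leaves V T)"
    by (simp add: mult.commute)
  moreover have "(\<Sum>v\<in>V - B. degree T v) + (\<Sum>v\<in>B. degree T v) = 2 * card T"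
    using sum.subset_diff[OF B fin, of "degree T"] handshake[OF fin T] by presburger
  moreover have "card (V - B) + card B = card V"
    using card_Diff_subset[OF fB B] card_mono[OF fin B] by linarith
  ultimately show ?thesis using cT by linarith
qed

section \<open>Spanning trees of joined graphs\<close>

text \<open>In other words, \<open>E\<close> has no bipartite hole with both sides of size
  \<open>k\<close>. Stating it for sizes at least \<open>k\<close> avoids trimming the sets to which
  it is applied.\<close>

definition joined :: "'a set \<Rightarrow> nat \<Rightarrow> 'a set set \<Rightarrow> bool" where
  "joined V k E \<longleftrightarrow> (\<forall>A B. A \<subseteq> V \<and> B \<subseteq> V \<and> A \<inter> B = {} \<and> k \<le> card A \<and> k \<le> card B \<longrightarrow>
     (\<exists>a\<in>A. \<exists>b\<in>B. {a, b} \<in> E))"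

text \<open>Fix \<open>k\<close> centres among \<open>5 * k\<close> vertices. Fewer than
  \<open>k\<close> of the other \<open>4 * k\<close> lack a neighbour among the centres, and each
  remaining one picks a centre. Working inside only \<open>5 * k\<close> vertices keeps the star
  forest small, since its colours are not controlled.\<close>

lemma joined_stars:
  assumes j: "joined V k E" and V5: "5 * k \<le> card V"
  shows "\<exists>A B h. A \<subseteq> V \<and> B \<subseteq> V \<and> A \<inter> B = {} \<and> h ` A \<subseteq> B \<and> card B = k \<and>
    3 * k \<le> card A \<and> card A \<le> 4 * k \<and> (\<forall>a\<in>A. {h a, a} \<in> E)"
proof -
  obtain W where W: "W \<subseteq> V" "card W = 5 * k" "finite W"
    using V5 by (metis obtain_subset_with_card_n)
  obtain B where B: "B \<subseteq> W" "card B = k" "finite B"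
    using W(2) obtain_subset_with_card_n[of k W] by auto
  define A where "A = {a \<in> W - B. \<exists>b\<in>B. {b, a} \<in> E}"
  have cWB: "card (W - B) = 4 * k"
    using W B by (simp add: card_Diff_subset)
  have "\<not> k \<le> card (W - B - A)"
  proof
    assume "k \<le> card (W - B - A)"
    moreover have "B \<subseteq> V" "W - B - A \<subseteq> V" "B \<inter> (W - B - A) = {}" "k \<le> card B"
      using B(1,2) W(1) by auto
    ultimately have "\<exists>b\<in>B. \<exists>a\<in>W - B - A. {b, a} \<in> E"
      using j unfolding joined_def by blast
    then show False by (auto simp: A_def)
  qed
  moreover have "card (W - B - A) = card (W - B) - card A"
    using W(3) by (intro card_Diff_subset) (auto simp: A_def)
  moreover have "card A \<le> card (W - B)"
    using W(3) by (intro card_mono) (auto simp: A_def)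
  ultimately have card_A: "3 * k \<le> card A" "card A \<le> 4 * k"
    using cWB by linarith+
  have "\<forall>a\<in>A. \<exists>b. b \<in> B \<and> {b, a} \<in> E" by (auto simp: A_def)
  from bchoice[OF this] obtain h where h: "\<forall>a\<in>A. h a \<in> B \<and> {h a, a} \<in> E" ..
  have "A \<subseteq> V" "B \<subseteq> V" "A \<inter> B = {}"
    using W(1) B(1) by (auto simp: A_def)
  then show ?thesis
    using h B(2) card_A by (intro exI[of _ A] exI[of _ B] exI[of _ h]) auto
qed

lemma monochromatic_spanning_tree:
  assumes fin: "finite V" and E: "E \<subseteq> all_edges V" and con: "connected_graph V E"
    and j: "joined V k E" and k: "0 < k" and V5: "5 * k \<le> card V"
  shows "\<exists>T. spanning_tree V E T \<and> k \<le> card (leaves V T) \<and>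
    (\<exists>b::bool. card V \<le> card {e \<in> T. col e = b} + 7 * k)"
proof -
  have fE: "finite E" using fin E finite_all_edges finite_subset by blast
  obtain A B h where AB: "A \<subseteq> V" "B \<subseteq> V" "A \<inter> B = {}" "h ` A \<subseteq> B" "card B = k"
    "3 * k \<le> card A" "card A \<le> 4 * k" "\<forall>a\<in>A. {h a, a} \<in> E"
    using joined_stars[OF j V5] by (elim exE conjE)
  have fA: "finite A" and fB: "finite B"
    using AB(1,2) fin by (auto intro: finite_subset)
  define S where "S = (\<lambda>a. {h a, a}) ` A"
  have SE: "S \<subseteq> E" using AB(8) by (auto simp: S_def)
  obtain s where s: "labelled_forest S s"
    using labelled_forest_stars[OF fA, of h] AB(3,4) unfolding S_def by blast
  have ext: "\<exists>F f. labelled_forest F f \<and> S \<subseteq> F \<and> F \<subseteq> S \<union> {e \<in> E. col e = b} \<and>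
    (\<forall>u v. {u, v} \<in> {e \<in> E. col e = b} \<longrightarrow> f u = f v)" for b
    by (rule labelled_forest_extend[OF _ s]) (use fE in simp)
  obtain F1 f1 where F1: "labelled_forest F1 f1" "S \<subseteq> F1" "F1 \<subseteq> S \<union> {e \<in> E. col e}"
    "\<And>u v. {u, v} \<in> E \<Longrightarrow> col {u, v} \<Longrightarrow> f1 u = f1 v"
    using ext[of True] by auto
  obtain F2 f2 where F2: "labelled_forest F2 f2" "S \<subseteq> F2" "F2 \<subseteq> S \<union> {e \<in> E. \<not> col e}"
    "\<And>u v. {u, v} \<in> E \<Longrightarrow> \<not> col {u, v} \<Longrightarrow> f2 u = f2 v"
    using ext[of False] by auto
  have "card (f1 ` V) < 3 * k \<or> card (f2 ` V) < 3 * k"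
  proof (rule ccontr)
    assume "\<not> ?thesis"
    then have ge: "3 * k \<le> card (f1 ` V)" "3 * k \<le> card (f2 ` V)" by auto
    obtain A' B' where C: "A' \<subseteq> V" "B' \<subseteq> V" "k \<le> card A'" "k \<le> card B'"
      "f1 ` A' \<inter> f1 ` B' = {}" "f2 ` A' \<inter> f2 ` B' = {}"
      using two_labellings_split[OF fin ge] by blast
    then have "A' \<inter> B' = {}" by auto
    then obtain x y where xy: "x \<in> A'" "y \<in> B'" "{x, y} \<in> E"
      using j C(1-4) unfolding joined_def by blast
    have "f1 x \<noteq> f1 y" "f2 x \<noteq> f2 y"
      using C(5,6) xy(1,2) by auto
    then show False
      using F1(4)[OF xy(3)] F2(4)[OF xy(3)] by blast
  qed
  then obtain b F f where F: "labelled_forest F f" "S \<subseteq> F" "F \<subseteq> S \<union> {e \<in> E. col e = b}"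
    and card_f: "card (f ` V) < 3 * k"
  proof (elim disjE)
    assume "card (f1 ` V) < 3 * k"
    with F1(1-3) show thesis by (intro that[of F1 f1 True]) auto
  next
    assume "card (f2 ` V) < 3 * k"
    with F2(1-3) show thesis by (intro that[of F2 f2 False]) auto
  qed
  obtain T t where T: "labelled_forest T t" "F \<subseteq> T" "T \<subseteq> F \<union> E"
    "\<And>u v. {u, v} \<in> E \<Longrightarrow> t u = t v"
    using labelled_forest_extend[OF fE F(1)] by blast
  have TE: "T \<subseteq> E" using T(3) F(3) SE by auto
  then have TV: "T \<subseteq> all_edges V" and fT: "finite T"
    using E fE finite_subset by auto
  \<comment> \<open>The label \<open>t\<close> is constant along edges of the connected graph, so
    only one component is left.\<close>
  have t: "t u = t v" if "u \<in> V" "v \<in> V" for u v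
  proof -
    have "(u, v) \<in> {(x, y). {x, y} \<in> E}\<^sup>*"
      using con that by (auto simp: connected_graph_def)
    then show ?thesis by induction (use T(4) in auto)
  qed
  have V0: "V \<noteq> {}" using con by (simp add: connected_graph_def)
  have conT: "connected_graph V T"
    unfolding connected_graph_def using V0 by (intro conjI ballI labelled_forest_connected[OF T(1)] t)
  have span: "spanning_tree V E T"
    using TE TV conT labelled_forest_acyclic[OF T(1)] by (auto simp: spanning_tree_def tree_def)
  from V0 have "card (t ` V) > 0" using fin by (simp add: card_gt_0_iff)
  then have cT: "card T < card V"
    using labelled_forest_card[OF T(1) TV fin] by linarith
  \<comment> \<open>All star edges survive in \<open>T\<close>, so the \<open>k\<close> centres have
    total degree at least \<open>3 * k\<close>. This exceeds two per centre by at least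
    \<open>k\<close>, which forces \<open>k\<close> leaves.\<close>
  have "card A \<le> (\<Sum>v\<in>B. card {a \<in> A. h a = v})"
  proof -
    have "card A = card (\<Union>v\<in>B. {a \<in> A. h a = v})"
      using AB(4) by (intro arg_cong[where f = card]) auto
    also have "\<dots> \<le> (\<Sum>v\<in>B. card {a \<in> A. h a = v})"
      using fB by (rule card_UN_le)
    finally show ?thesis .
  qed
  also have "\<dots> \<le> (\<Sum>v\<in>B. degree T v)"
  proof (rule sum_mono)
    fix v assume v: "v \<in> B"
    have "inj_on (\<lambda>a. {v, a}) {a \<in> A. h a = v}"
      using AB(3) v by (auto simp: inj_on_def doubleton_eq_iff)
    moreover have "(\<lambda>a. {v, a}) ` {a \<in> A. h a = v} \<subseteq> {e \<in> T. v \<in> e}"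
      using F(2) T(2) by (auto simp: S_def)
    ultimately show "card {a \<in> A. h a = v} \<le> degree T v"
      unfolding degree_def using fT by (intro card_inj_on_le[of "\<lambda>a. {v, a}"]) auto
  qed
  also have "\<dots> \<le> card (leaves V T) + 2 * card B"
    using k V5 by (intro leaves_ge_of_degree_sum fin TV conT cT AB(2)) linarith
  finally have leaves: "k \<le> card (leaves V T)" using AB(5,6) by linarith
  have FV: "F \<subseteq> all_edges V" using F(3) SE E by blast
  \<comment> \<open>The loss \<open>7 * k\<close> has two sources: at most \<open>4 * k\<close>
    edges of \<open>F\<close> lie in \<open>S\<close> and may have the wrong colour, and
    \<open>F\<close> has fewer than \<open>3 * k\<close> components, hence more than
    \<open>card V - 3 * k\<close> edges.\<close>
  have "card F \<le> card (S \<union> {e \<in> T. col e = b})"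
    using F(3) T(2) fT fE SE finite_subset by (intro card_mono) auto
  also have "\<dots> \<le> card S + card {e \<in> T. col e = b}" by (rule card_Un_le)
  also have "card S \<le> 4 * k" using card_image_le[OF fA, of "\<lambda>a. {h a, a}"] AB(7) by (simp add: S_def)
  finally have "card V \<le> card {e \<in> T. col e = b} + 7 * k"
    using labelled_forest_card[OF F(1) FV fin] card_f by linarith
  with span leaves show ?thesis by blast
qed

section \<open>The random graph\<close>

definition crossing :: "'a set \<Rightarrow> 'a set \<Rightarrow> 'a set set" where
  "crossing A B = (\<lambda>(a, b). {a, b}) ` (A \<times> B)"

lemma card_crossing:
  assumes "A \<inter> B = {}"
  shows "card (crossing A B) = card A * card B"
proof -
  have "inj_on (\<lambda>(a, b). {a, b}) (A \<times> B)"
    using assms by (auto simp: inj_on_def doubleton_eq_iff)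
  then show ?thesis
    by (simp add: crossing_def card_image card_cartesian_product)
qed

lemma crossing_subset_all_edges:
  assumes "A \<subseteq> V" "B \<subseteq> V" "A \<inter> B = {}"
  shows "crossing A B \<subseteq> all_edges V"
  using assms by (auto simp: crossing_def all_edges_def card_insert_if)

lemma prob_gnp_avoid:
  assumes D: "D \<subseteq> all_edges {..<n}" and p: "0 \<le> p" "p \<le> 1"
  shows "measure_pmf.prob (gnp n p) {G. G \<inter> D = {}} = (1 - p) ^ card D"
proof -
  let ?U = "all_edges {..<n}"
  have fin: "finite ?U" by (simp add: finite_all_edges)
  \<comment> \<open>Avoiding \<open>D\<close> is a product event: coordinates in \<open>D\<close>
    must be \<open>False\<close> and all others are free.\<close>
  have "(\<lambda>f. {e \<in> ?U. f e}) -` {G. G \<inter> D = {}} = Pi ?U (\<lambda>e. if e \<in> D then {False} else UNIV)"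
    using D by (auto simp: Pi_def split: if_splits)
  then have "measure_pmf.prob (gnp n p) {G. G \<inter> D = {}} =
      (\<Prod>e\<in>?U. measure_pmf.prob (bernoulli_pmf p) (if e \<in> D then {False} else UNIV))"
    by (simp add: gnp_def measure_Pi_pmf_Pi[OF fin])
  also have "\<dots> = (\<Prod>e\<in>?U. if e \<in> D then 1 - p else 1)"
    using p by (intro prod.cong) (auto simp: measure_pmf_single)
  also have "\<dots> = (1 - p) ^ card D"
    using D fin by (simp add: prod.If_cases Int_absorb1)
  finally show ?thesis .
qed

lemma set_pmf_gnp: "set_pmf (gnp n p) \<subseteq> Pow (all_edges {..<n})"
  by (auto simp: gnp_def)

lemma one_minus_power_le_exp:
  fixes p :: real
  assumes "p \<le> 1"
  shows "(1 - p) ^ m \<le> exp (- (p * real m))"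
proof -
  have "(1 - p) ^ m \<le> exp (- p) ^ m"
    using assms exp_ge_add_one_self[of "- p"] by (intro power_mono) auto
  then show ?thesis
    by (simp add: exp_of_nat_mult[symmetric] mult.commute)
qed

text \<open>Union bound over at most \<open>4 ^ n\<close> pairs of sets, each of which needs at
  least \<open>k ^ 2\<close> absent edges. The crude count is harmless when \<open>k\<close> is
  linear in \<open>n\<close>, because \<open>p * k ^ 2\<close> is then at least of order
  \<open>n ln n\<close>.\<close>

lemma prob_gnp_not_joined:
  assumes p: "0 \<le> p" "p \<le> 1"
  shows "measure_pmf.prob (gnp n p) {G. \<not> joined {..<n} k G} \<le> 4 ^ n * exp (- (p * real k ^ 2))"
proof -
  define I where "I = {(A, B). A \<subseteq> {..<n} \<and> B \<subseteq> {..<n} \<and> A \<inter> B = {} \<and> k \<le> card A \<and> k \<le> card B}"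
  let ?X = "\<lambda>(A, B). {G. G \<inter> crossing A B = {}}"
  have I: "I \<subseteq> Pow {..<n} \<times> Pow {..<n}" unfolding I_def by blast
  then have fI: "finite I" by (rule finite_subset) simp
  have "card I \<le> card (Pow {..<n} \<times> Pow {..<n})"
    by (rule card_mono[OF _ I]) simp
  also have "\<dots> = 2 ^ n * 2 ^ n"
    by (simp only: card_cartesian_product card_Pow finite_lessThan card_lessThan)
  also have "\<dots> = (2 * 2) ^ n"
    by (rule power_mult_distrib[symmetric])
  finally have "real (card I) \<le> real ((2 * 2) ^ n)" by (rule of_nat_mono)
  then have cI: "real (card I) \<le> 4 ^ n" by simp
  have "{G. \<not> joined {..<n} k G} \<subseteq> (\<Union>i\<in>I. ?X i)"
  proof
    fix G assume "G \<in> {G. \<not> joined {..<n} k G}"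
    then have "\<exists>A B. (A \<subseteq> {..<n} \<and> B \<subseteq> {..<n} \<and> A \<inter> B = {} \<and> k \<le> card A \<and> k \<le> card B) \<and>
        \<not> (\<exists>a\<in>A. \<exists>b\<in>B. {a, b} \<in> G)"
      by (simp only: mem_Collect_eq joined_def not_all not_imp)
    then obtain A B where
      AB: "A \<subseteq> {..<n} \<and> B \<subseteq> {..<n} \<and> A \<inter> B = {} \<and> k \<le> card A \<and> k \<le> card B"
      and no_edge: "\<not> (\<exists>a\<in>A. \<exists>b\<in>B. {a, b} \<in> G)"
      by (elim exE) (erule conjE, rule that)
    have "(A, B) \<in> I"
      unfolding I_def using AB by simp
    moreover have "G \<in> ?X (A, B)"
      using no_edge by (auto simp: crossing_def)
    ultimately show "G \<in> (\<Union>i\<in>I. ?X i)" by (rule UN_I)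
  qed
  then have "measure_pmf.prob (gnp n p) {G. \<not> joined {..<n} k G} \<le>
      measure_pmf.prob (gnp n p) (\<Union>i\<in>I. ?X i)"
    by (intro measure_pmf.finite_measure_mono) simp_all
  also have "\<dots> \<le> (\<Sum>i\<in>I. measure_pmf.prob (gnp n p) (?X i))"
    by (intro measure_UNION_le fI) simp
  also have "\<dots> \<le> (\<Sum>i\<in>I. exp (- (p * real k ^ 2)))"
  proof (rule sum_mono)
    fix i assume "i \<in> I"
    moreover obtain A B where "i = (A, B)" by (cases i)
    ultimately have i: "i = (A, B)" "A \<subseteq> {..<n}" "B \<subseteq> {..<n}" "A \<inter> B = {}"
      "k \<le> card A" "k \<le> card B"
      by (simp_all add: I_def)
    have "measure_pmf.prob (gnp n p) (?X i) = (1 - p) ^ (card A * card B)"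
      using prob_gnp_avoid[OF crossing_subset_all_edges[OF i(2-4)] p] i(1,4)
      by (simp add: card_crossing)
    also have "\<dots> \<le> (1 - p) ^ (k * k)"
      using p i(5,6) by (intro power_decreasing mult_le_mono) auto
    also have "\<dots> \<le> exp (- (p * real (k * k)))"
      by (rule one_minus_power_le_exp[OF p(2)])
    finally show "measure_pmf.prob (gnp n p) (?X i) \<le> exp (- (p * real k ^ 2))"
      by (simp add: power2_eq_square)
  qed
  also have "\<dots> \<le> 4 ^ n * exp (- (p * real k ^ 2))"
    using cI by (simp add: mult_right_mono)
  finally show ?thesis .
qed

section \<open>Cuts in disconnected graphs and their union bound\<close>

lemma disconnected_cut:
  assumes "finite V" "V \<noteq> {}" "\<not> connected_graph V E"
  shows "\<exists>S \<subseteq> V. 1 \<le> card S \<and> card S \<le> card V div 2 \<and> E \<inter> crossing S (V - S) = {}"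
proof -
  let ?R = "{(x, y). {x, y} \<in> E}"
  obtain u v where uv: "u \<in> V" "v \<in> V" "(u, v) \<notin> ?R\<^sup>*"
    using assms(2,3) by (auto simp: connected_graph_def)
  let ?C = "{x \<in> V. (u, x) \<in> ?R\<^sup>*}"
  have cut: "E \<inter> crossing ?C (V - ?C) = {}"
    by (auto simp: crossing_def dest: rtrancl_into_rtrancl[where r = ?R])
  have "V - (V - ?C) = ?C" by auto
  then have cut': "E \<inter> crossing (V - ?C) (V - (V - ?C)) = {}"
    using cut by (auto simp: crossing_def insert_commute)
  have ne: "?C \<noteq> {}" "V - ?C \<noteq> {}" using uv by auto
  then have pos: "1 \<le> card ?C" "1 \<le> card (V - ?C)"
    using assms(1) by (simp_all add: Suc_le_eq card_gt_0_iff)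
  have "card (V - ?C) = card V - card ?C" "card ?C \<le> card V"
    using assms(1) by (auto intro!: card_Diff_subset card_mono)
  \<comment> \<open>The component of \<open>u\<close> and its complement define the same cut, so the
    smaller side may be taken.\<close>
  then have "card ?C \<le> card V div 2 \<or> card (V - ?C) \<le> card V div 2" by linarith
  then show ?thesis
  proof
    assume "card ?C \<le> card V div 2"
    with cut pos(1) show ?thesis by (intro exI[of _ ?C] conjI) simp_all
  next
    assume "card (V - ?C) \<le> card V div 2"
    with cut' pos(2) show ?thesis by (intro exI[of _ "V - ?C"] conjI) blast+
  qed
qed

lemma prob_gnp_disconnected:
  assumes n: "1 \<le> n" and p: "0 \<le> p" "p \<le> 1"
  shows "measure_pmf.prob (gnp n p) {G. \<not> connected_graph {..<n} G} \<le>
    (\<Sum>s = 1..n div 2. real (n choose s) * (1 - p) ^ (s * (n - s)))"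
proof -
  let ?I = "\<lambda>s. {S. S \<subseteq> {..<n} \<and> card S = s}"
  let ?X = "\<lambda>S. {G. G \<inter> crossing S ({..<n} - S) = {}}"
  have fI: "finite (?I s)" for s by simp
  have "{G. \<not> connected_graph {..<n} G} \<subseteq> (\<Union>s\<in>{1..n div 2}. \<Union>S\<in>?I s. ?X S)"
  proof
    fix G assume "G \<in> {G. \<not> connected_graph {..<n} G}"
    then obtain S where "S \<subseteq> {..<n}" "1 \<le> card S" "card S \<le> n div 2"
      "G \<inter> crossing S ({..<n} - S) = {}"
      using disconnected_cut[of "{..<n}" G] n by (auto simp: lessThan_empty_iff)
    then show "G \<in> (\<Union>s\<in>{1..n div 2}. \<Union>S\<in>?I s. ?X S)"
      by (intro UN_I[of "card S"] UN_I[of S]) simp_all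
  qed
  then have "measure_pmf.prob (gnp n p) {G. \<not> connected_graph {..<n} G} \<le>
      measure_pmf.prob (gnp n p) (\<Union>s\<in>{1..n div 2}. \<Union>S\<in>?I s. ?X S)"
    by (intro measure_pmf.finite_measure_mono) auto
  also have "\<dots> \<le> (\<Sum>s = 1..n div 2. measure_pmf.prob (gnp n p) (\<Union>S\<in>?I s. ?X S))"
    by (intro measure_UNION_le) auto
  also have "\<dots> \<le> (\<Sum>s = 1..n div 2. \<Sum>S\<in>?I s. measure_pmf.prob (gnp n p) (?X S))"
    by (intro sum_mono measure_UNION_le fI) simp
  also have "\<dots> = (\<Sum>s = 1..n div 2. \<Sum>S\<in>?I s. (1 - p) ^ (s * (n - s)))"
  proof (intro sum.cong refl)
    fix s S assume "S \<in> ?I s"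
    then have S: "S \<subseteq> {..<n}" "card S = s" "finite S"
      using finite_subset by auto
    then have "card ({..<n} - S) = n - s" by (simp add: card_Diff_subset)
    then show "measure_pmf.prob (gnp n p) (?X S) = (1 - p) ^ (s * (n - s))"
      using prob_gnp_avoid[OF crossing_subset_all_edges[OF S(1) Diff_subset] p] S
      by (simp add: card_crossing)
  qed
  also have "\<dots> = (\<Sum>s = 1..n div 2. real (n choose s) * (1 - p) ^ (s * (n - s)))"
    using n_subsets[of "{..<n}"] by simp
  finally show ?thesis .
qed

section \<open>Estimating the sum over cuts\<close>

lemma power_self_le_exp_fact: "real s ^ s \<le> exp (real s) * fact s"
proof -
  \<comment> \<open>The quotient of \<open>s ^ s\<close> by \<open>fact s\<close> is a single term
    of the exponential series at \<open>s\<close>.\<close>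
  have "(\<Sum>i\<in>{s}. inverse (fact i) * real s ^ i) \<le> (\<Sum>i. inverse (fact i) * real s ^ i)"
    by (intro sum_le_suminf summable_exp) auto
  also have "\<dots> = exp (real s)"
    by (simp add: exp_def)
  finally show ?thesis
    by (simp add: field_simps)
qed

text \<open>This is the standard bound (e n / s)^s, written as an exponential so that it combines
  with the bound for absent edges.\<close>

lemma choose_le_exp:
  assumes "1 \<le> s" "1 \<le> n"
  shows "real (n choose s) \<le> exp (real s * (ln (real n) + 1 - ln (real s)))"
proof -
  have "real (n choose s) * real s ^ s \<le> real (n choose s) * (exp (real s) * fact s)"
    by (intro mult_left_mono power_self_le_exp_fact) simp
  also have "\<dots> = exp (real s) * real ((n choose s) * fact s)"
    by simp
  also have "\<dots> \<le> exp (real s) * real (n ^ s)"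
    by (intro mult_left_mono of_nat_mono binomial_fact_pow) simp
  finally have "real (n choose s) * real s ^ s \<le> exp (real s) * real n ^ s"
    by simp
  then have "real (n choose s) \<le> exp (real s) * real n ^ s / real s ^ s"
    using assms by (simp add: pos_le_divide_eq)
  also have "\<dots> = exp (real s * (ln (real n) + 1 - ln (real s)))"
    using assms exp_of_nat_mult[of s "1::real"]
    by (simp add: exp_of_nat_mult exp_add exp_diff power_divide power_mult_distrib)
  finally show ?thesis .
qed

text \<open>Split \<open>ln n\<close> as \<open>ln s + ln (n / s)\<close>: the first part has weight
  at most 1, and x ln (1/x) is at most 1 for x = s/n. This controls the correction
  \<open>p * s\<close> that arises because a cut has \<open>s * (n - s)\<close> pairs rather than
  \<open>s * n\<close>.\<close>

lemma ln_mult_ratio_le: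
  fixes s n :: real
  assumes "1 \<le> s" "s \<le> n"
  shows "s * ln n / n \<le> ln s + 1"
proof -
  have "ln n = ln s + ln (n / s)"
    using assms by (simp add: ln_div)
  then have "s * ln n / n = s / n * ln s + s / n * ln (n / s)"
    by (simp add: algebra_simps add_divide_distrib)
  also have "s / n * ln s \<le> 1 * ln s"
    using assms by (intro mult_right_mono) auto
  also have "s / n * ln (n / s) \<le> s / n * (n / s)"
    using assms ln_le_minus_one[of "n / s"] by (intro mult_left_mono) auto
  also have "s / n * (n / s) = 1"
    using assms by simp
  finally show ?thesis by simp
qed

text \<open>In the exponent divided by \<open>s\<close>, the term \<open>p * n\<close> cancels
  \<open>ln n\<close> and leaves \<open>- w\<close>. The correction \<open>p * s\<close> costs at
  most \<open>ln s + 1 + w / 2\<close>, where \<open>s\<close> being at most half of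
  \<open>n\<close> is used, and this \<open>ln s\<close> cancels too. The resulting bound is
  geometric in \<open>s\<close>.\<close>

lemma disconnection_term_le:
  assumes s: "1 \<le> s" "s \<le> n div 2" and w: "0 \<le> w" and p: "p = (ln (real n) + w) / real n" "p \<le> 1"
  shows "real (n choose s) * (1 - p) ^ (s * (n - s)) \<le> exp (2 - w / 2) ^ s"
proof -
  have n: "1 \<le> n" "s \<le> n" "2 * real s \<le> real n" using s by auto
  let ?a = "ln (real n) + 1 - ln (real s) - p * (real n - real s)"
  have "p * real n = ln (real n) + w" "p * real s = real s * ln (real n) / real n + w * (real s / real n)"
    using n by (simp_all add: p(1) add_divide_distrib algebra_simps)
  then have "?a = 1 - ln (real s) - w + (real s * ln (real n) / real n + w * (real s / real n))"
    by (simp add: right_diff_distrib)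
  also have "real s * ln (real n) / real n \<le> ln (real s) + 1"
    using s n by (intro ln_mult_ratio_le) auto
  also have "w * (real s / real n) \<le> w * (1 / 2)"
    using n w by (intro mult_left_mono) (auto simp: divide_simps)
  finally have a: "?a \<le> 2 - w / 2" by simp
  have "real (n choose s) * (1 - p) ^ (s * (n - s)) \<le>
      exp (real s * (ln (real n) + 1 - ln (real s))) * exp (- (p * real (s * (n - s))))"
    using s n p by (intro mult_mono choose_le_exp one_minus_power_le_exp) auto
  also have "\<dots> = exp (real s * ?a)"
    using n by (simp add: exp_add[symmetric] of_nat_diff algebra_simps)
  also have "\<dots> \<le> exp (real s * (2 - w / 2))"
    using a by (simp add: mult_left_mono)
  also have "\<dots> = exp (2 - w / 2) ^ s"
    by (simp add: exp_of_nat_mult)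
  finally show ?thesis .
qed

lemma geometric_sum_le:
  fixes q :: real
  assumes "0 \<le> q" "q < 1"
  shows "(\<Sum>s = 1..m. q ^ s) \<le> q / (1 - q)"
proof -
  have "(1 - q) * (\<Sum>s = 1..m. q ^ s) = q - q ^ Suc m"
  proof (induction m)
    case (Suc m)
    have "(1 - q) * (\<Sum>s = 1..Suc m. q ^ s) = (1 - q) * (\<Sum>s = 1..m. q ^ s) + (1 - q) * q ^ Suc m"
      by (simp add: distrib_left)
    also have "\<dots> = q - q ^ Suc (Suc m)"
      unfolding Suc.IH by (simp add: algebra_simps)
    finally show ?case .
  qed simp
  also have "\<dots> \<le> q" using assms by simp
  finally show ?thesis
    using assms by (simp add: pos_le_divide_eq mult.commute)
qed

section \<open>Combining the estimates for fixed n and passing to the limit\<close>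

lemma prob_gnp_tree_ge:
  fixes n :: nat and w p :: real
  assumes n: "40 \<le> n" and w: "5 \<le> w" and p: "p = (ln (real n) + w) / real n" "0 \<le> p" "p \<le> 1"
  shows "1 - (4 ^ n * exp (- (ln (real n) / real n * (real n / 40) ^ 2)) +
      exp (2 - w / 2) / (1 - exp (2 - w / 2)))
    \<le> measure_pmf.prob (gnp n p)
        {G. \<forall>col :: nat set \<Rightarrow> bool. \<exists>T. spanning_tree {..<n} G T \<and>
          real (card (leaves {..<n} T)) \<ge> 1 / 40 * real n \<and>
          (\<exists>b. real (card {e \<in> T. col e = b}) > (1 + 1 / 10) / 2 * real n)}"
    (is "1 - (?b1 + ?b2) \<le> measure_pmf.prob _ ?Good")
proof -
  let ?P = "measure_pmf.prob (gnp n p)"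
  define k where "k = n div 20"
  let ?D = "{G. \<not> connected_graph {..<n} G}" and ?J = "{G. \<not> joined {..<n} k G}"
  \<comment> \<open>From \<open>40 \<le> n\<close> the floor in \<open>k\<close> costs at most a
    factor 2, which gives the leaf constant 1/40. From \<open>20 * k \<le> n\<close> a tree with
    \<open>n - 7 * k\<close> edges of one colour has at least 13n/20 of them, more than the required
    11n/20.\<close>
  have k: "real n / 40 \<le> real k" "20 * k \<le> n" "0 < k"
    using n by (auto simp: k_def)
  have good: "G \<in> ?Good" if G: "G \<subseteq> all_edges {..<n}" "connected_graph {..<n} G" "joined {..<n} k G" for G
  proof -
    have "\<exists>T. spanning_tree {..<n} G T \<and>
          real (card (leaves {..<n} T)) \<ge> 1 / 40 * real n \<and>
          (\<exists>b. real (card {e \<in> T. col e = b}) > (1 + 1 / 10) / 2 * real n)" for col :: "nat set \<Rightarrow> bool"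
    proof -
      obtain T b where T: "spanning_tree {..<n} G T" "k \<le> card (leaves {..<n} T)"
        "n \<le> card {e \<in> T. col e = b} + 7 * k"
        using monochromatic_spanning_tree[OF _ G k(3), of col] k(2) by auto
      have "real n \<le> real (card {e \<in> T. col e = b}) + 7 * real k" "20 * real k \<le> real n"
        using T(3) k(2) by linarith+
      then have "real (card {e \<in> T. col e = b}) > (1 + 1 / 10) / 2 * real n"
        using n by simp
      then show ?thesis
        using T(1,2) k(1) by (intro exI[of _ T] conjI exI[of _ b]) auto
    qed
    then show ?thesis by blast
  qed
  \<comment> \<open>Intersecting with the support ensures that \<open>G\<close> consists of pairs of
    vertices, as \<open>good\<close> requires.\<close>
  have "- ?Good \<inter> set_pmf (gnp n p) \<subseteq> ?J \<union> ?D"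
    using good set_pmf_gnp[of n p] by blast
  then have "?P (- ?Good \<inter> set_pmf (gnp n p)) \<le> ?P (?J \<union> ?D)"
    by (intro measure_pmf.finite_measure_mono) auto
  then have "?P (- ?Good) \<le> ?P ?J + ?P ?D"
    using measure_Un_le[of ?J "gnp n p" ?D] by (simp add: measure_Int_set_pmf)
  moreover have "?P (- ?Good) = 1 - ?P ?Good"
    using measure_pmf.prob_compl[of ?Good "gnp n p"] by (simp add: Compl_eq_Diff_UNIV)
  moreover have "?P ?J \<le> ?b1"
  proof -
    have "ln (real n) / real n \<le> p"
      using w n p(1) by (simp add: divide_right_mono)
    moreover have "(real n / 40) ^ 2 \<le> real k ^ 2"
      using k(1) by (intro power_mono) auto
    ultimately have "ln (real n) / real n * (real n / 40) ^ 2 \<le> p * real k ^ 2"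
      using p(2) by (intro mult_mono) auto
    then have "4 ^ n * exp (- (p * real k ^ 2)) \<le> ?b1" by simp
    then show ?thesis
      using prob_gnp_not_joined[OF p(2,3), of n k] by linarith
  qed
  moreover have "?P ?D \<le> ?b2"
  proof -
    have "?P ?D \<le> (\<Sum>s = 1..n div 2. real (n choose s) * (1 - p) ^ (s * (n - s)))"
      using n by (intro prob_gnp_disconnected p(2,3)) simp
    also have "\<dots> \<le> (\<Sum>s = 1..n div 2. exp (2 - w / 2) ^ s)"
      using w by (intro sum_mono disconnection_term_le p(1,3)) auto
    also have "\<dots> \<le> ?b2"
      \<comment> \<open>Here \<open>5 \<le> w\<close> makes the ratio \<open>exp (2 - w / 2)\<close>
        less than 1.\<close>
      using w by (intro geometric_sum_le) auto
    finally show ?thesis .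
  qed
  ultimately show ?thesis by linarith
qed

theorem theorem1p3:
  shows "\<exists>\<epsilon>::real. \<exists>c::real. \<epsilon> > 0 \<and> c > 0 \<and>
    (\<forall>(w :: nat \<Rightarrow> real) (p :: nat \<Rightarrow> real).
       filterlim w at_top sequentially \<longrightarrow>
       (\<forall>\<^sub>F n in sequentially. p n = (ln (real n) + w n) / real n \<and> 0 \<le> p n \<and> p n \<le> 1) \<longrightarrow>
       (\<lambda>n. measure_pmf.prob (gnp n (p n))
              {G. \<forall>col :: nat set \<Rightarrow> bool. \<exists>T.
                    spanning_tree {..<n} G T \<and>
                    real (card (leaves {..<n} T)) \<ge> c * real n \<and>
                    (\<exists>b. real (card {e \<in> T. col e = b}) > (1 + \<epsilon>) / 2 * real n)})
         \<longlonglongrightarrow> 1)"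
proof (rule exI[of _ "1 / 10"], rule exI[of _ "1 / 40"], intro conjI allI impI)
  fix w p :: "nat \<Rightarrow> real"
  assume w: "filterlim w at_top sequentially"
    and p: "\<forall>\<^sub>F n in sequentially. p n = (ln (real n) + w n) / real n \<and> 0 \<le> p n \<and> p n \<le> 1"
  let ?b1 = "\<lambda>n. 4 ^ n * exp (- (ln (real n) / real n * (real n / 40) ^ 2))"
  let ?b2 = "\<lambda>n. exp (2 - w n / 2) / (1 - exp (2 - w n / 2))"
  \<comment> \<open>The exponent is n ln n / 1600, which outgrows the n ln 4 coming from
    \<open>4 ^ n\<close>.\<close>
  have b1: "?b1 \<longlonglongrightarrow> 0" by real_asymp
  have "((\<lambda>x::real. exp (2 - x / 2) / (1 - exp (2 - x / 2))) \<longlongrightarrow> 0) at_top" by real_asymp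
  from filterlim_compose[OF this w] have b2: "?b2 \<longlonglongrightarrow> 0" .
  let ?f = "\<lambda>n. measure_pmf.prob (gnp n (p n))
              {G. \<forall>col :: nat set \<Rightarrow> bool. \<exists>T.
                    spanning_tree {..<n} G T \<and>
                    real (card (leaves {..<n} T)) \<ge> 1 / 40 * real n \<and>
                    (\<exists>b. real (card {e \<in> T. col e = b}) > (1 + 1 / 10) / 2 * real n)}"
  have "(\<lambda>n. 1 - (?b1 n + ?b2 n)) \<longlonglongrightarrow> 1 - (0 + 0)"
    by (intro tendsto_intros b1 b2)
  then have "(\<lambda>n. 1 - (?b1 n + ?b2 n)) \<longlonglongrightarrow> 1" by simp
  moreover have "\<forall>\<^sub>F n in sequentially. 5 \<le> w n"
    using w by (simp add: filterlim_at_top)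
  then have "\<forall>\<^sub>F n in sequentially. 1 - (?b1 n + ?b2 n) \<le> ?f n"
    using p eventually_ge_at_top[of 40]
    by eventually_elim (rule prob_gnp_tree_ge, auto)
  moreover have "\<forall>\<^sub>F n in sequentially. ?f n \<le> 1"
    by (intro always_eventually allI measure_pmf.prob_le_1)
  ultimately show "?f \<longlonglongrightarrow> 1"
    by (rule tendsto_sandwich[rotated 2, OF _ tendsto_const])
qed auto

end
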